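(* Assume $K(x,y)>0$, $\mu(x)>0$, $\nu(y)>0$ for all $x,y\in S$. The map $g\mapsto m_g$ is $C^\infty$ on $\mathbb R^S$. For every $g\in\mathbb R^S$, its differential $Dm_g:\mathbb R^S\to\mathbb R^S$ is the linear operator $$\mathsf K_g:=Dm_g=\nabla^2\mathcal J(g)=\sum_{x\in S}\mu(x)\left[\operatorname{Diag}(p_g(\cdot|x))-p_g(\cdot|x)p_g(\cdot|x)^\top\right].$$ Equivalently, for every $h\in\mathbb R^S$ and every $y\in S$, $$(Dm_g[h])(y)=\sum_{x\in S}\mu(x)p_g(y|x)\left(h(y)-\sum_{z\in S}p_g(z|x)h(z)\right).$$
   Context: Let $N\ge1$ be an integer and $S=\{1,\dots,N\}$. Let $Q\in\mathbb R^{N\times N}$ be the generator of a continuous-time Markov chain on $S$ (nonnegative off-diagonal entries, rows summing to zero) and $K=e^{Q}$. Let $\mu,\nu$ be probability distributions on $S$. Functions $g:S\to\mathbb R$ are identified with vectors in $\mathbb R^S$. For $g\in\mathbb R^S$ set $Z_g(x)=\sum_{z\in S}K(x,z)e^{g(z)}$, $p_g(y|x)=\frac{K(x,y)e^{g(y)}}{Z_g(x)}$, $m_g(y)=\sum_{x\in S}\mu(x)p_g(y|x)$, and $$\mathcal J(g)=\sum_{x\in S}\mu(x)\log Z_g(x)-\sum_{y\in S}\nu(y)g(y).$$ $\nabla^2\mathcal J(g)$ is the Hessian with respect to the standard Euclidean inner product on $\mathbb R^S$; $\operatorname{Diag}(p)$ is the diagonal matrix with diagonal $p$, and $p_g(\cdot|x)$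 is viewed as a column vector in $\mathbb R^S$. *)

theory Defs
  imports "HOL-Analysis.Analysis" "HOL-Probability.Probability_Mass_Function"
begin

definition generator :: "real^'n^'n \<Rightarrow> bool" where
  "generator Q \<longleftrightarrow> (\<forall>x y. x \<noteq> y \<longrightarrow> 0 \<le> Q $ x $ y) \<and> (\<forall>x. (\<Sum>y\<in>UNIV. Q $ x $ y) = 0)"

text \<open>Multiplication and powers of the type class instance on vectors are componentwise,
  so powers of matrices have to be formed by iterating \<open>**\<close>.\<close>

definition mat_pow :: "real^'n^'n \<Rightarrow> nat \<Rightarrow> real^'n^'n" where
  "mat_pow A k = (((**) A) ^^ k) (mat 1)"

definition mat_exp :: "real^'n^'n \<Rightarrow> real^'n^'n" where
  "mat_exp A = (\<Sum>k. mat_pow A k /\<^sub>R fact k)"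

text \<open>The exponential series always converges, so \<^const>\<open>mat_exp\<close> is its actual limit.\<close>

lemma mat_exp_sums:
  fixes A :: "real^'n^'n"
  shows "(\<lambda>k. mat_pow A k /\<^sub>R fact k) sums mat_exp A"
proof -
  define b where "b = real CARD('n) * norm A"
  have entry: "\<bar>A $ i $ j\<bar> \<le> norm A" for i j
    by (meson Finite_Cartesian_Product.norm_nth_le component_le_norm_cart order_trans)
  have pow: "\<bar>mat_pow A k $ i $ j\<bar> \<le> b ^ k" for k i j
  proof (induction k arbitrary: i j)
    case 0
    then show ?case by (simp add: mat_pow_def mat_def)
  next
    case (Suc k)
    have "\<bar>mat_pow A (Suc k) $ i $ j\<bar> \<le> (\<Sum>l\<in>UNIV. \<bar>A $ i $ l * mat_pow A k $ l $ j\<bar>)"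
      by (simp add: mat_pow_def matrix_matrix_mult_def)
    also have "\<dots> \<le> (\<Sum>l\<in>(UNIV :: 'n set). norm A * b ^ k)"
      unfolding abs_mult by (intro sum_mono mult_mono entry Suc) auto
    also have "\<dots> = b ^ Suc k"
      by (simp add: b_def)
    finally show ?case .
  qed
  have row: "norm (mat_pow A k $ i) \<le> real CARD('n) * b ^ k" for k i
    using order_trans[OF norm_le_l1_cart sum_mono[OF pow]] by simp
  have "norm (mat_pow A k) \<le> (\<Sum>i\<in>UNIV. norm (mat_pow A k $ i))" for k
    unfolding norm_vec_def[of "mat_pow A k"] by (rule L2_set_le_sum) simp
  then have bound: "norm (mat_pow A k) \<le> real CARD('n) * (real CARD('n) * b ^ k)" for k
    by (rule order_trans) (use sum_mono[of "UNIV :: 'n set", OF row[of k]] in simp)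
  have "summable (\<lambda>k. mat_pow A k /\<^sub>R fact k)"
  proof (rule summable_comparison_test')
    show "summable (\<lambda>k. real CARD('n) * real CARD('n) * (b ^ k /\<^sub>R fact k))"
      by (intro summable_mult summable_exp_generic)
    show "norm (mat_pow A k /\<^sub>R fact k) \<le> real CARD('n) * real CARD('n) * (b ^ k /\<^sub>R fact k)" for k
      using bound[of k] by (simp add: field_simps)
  qed
  then show ?thesis
    unfolding mat_exp_def by (rule summable_sums)
qed

text \<open>For maps between finite-dimensional spaces, \<open>C\<^sup>k\<^sup>+\<^sup>1\<close> amounts to being differentiable
  with all directional derivatives of class \<open>C\<^sup>k\<close>.\<close>

primrec C_k :: "nat \<Rightarrow> ('a::euclidean_space \<Rightarrow> 'b::euclidean_space) \<Rightarrow> bool" where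
  "C_k 0 f \<longleftrightarrow> continuous_on UNIV f"
| "C_k (Suc k) f \<longleftrightarrow> (\<forall>x. f differentiable (at x)) \<and>
     (\<forall>v. C_k k (\<lambda>x. frechet_derivative f (at x) v))"

definition smooth :: "('a::euclidean_space \<Rightarrow> 'b::euclidean_space) \<Rightarrow> bool" where
  "smooth f \<longleftrightarrow> (\<forall>k. C_k k f)"

text \<open>The Hessian as a linear operator: the derivative of the gradient, where the gradient
  is taken with respect to the inner product of the space.\<close>

definition has_hessian :: "('a::real_inner \<Rightarrow> real) \<Rightarrow> ('a \<Rightarrow> 'a) \<Rightarrow> 'a \<Rightarrow> bool" where
  "has_hessian f H x \<longleftrightarrow>
     (\<exists>G. (\<forall>\<^sub>F y in nhds x. GDERIV f y :> G y) \<and> (G has_derivative H) (at x))"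

definition Diag :: "real^'n \<Rightarrow> real^'n^'n" where
  "Diag p = (\<chi> i j. if i = j then p $ i else 0)"

definition outer :: "real^'n \<Rightarrow> real^'n \<Rightarrow> real^'n^'n" where
  "outer p q = (\<chi> i j. p $ i * q $ j)"

text \<open>The state space is the finite index type \<open>'n\<close>; functions on it are vectors in
  \<open>real^'n\<close>, and \<open>K $ x $ y\<close> is the kernel entry from \<open>x\<close> to \<open>y\<close>.\<close>

definition Z_g :: "real^'n^'n \<Rightarrow> real^'n \<Rightarrow> 'n \<Rightarrow> real" where
  "Z_g K g x = (\<Sum>z\<in>UNIV. K $ x $ z * exp (g $ z))"

definition p_g :: "real^'n^'n \<Rightarrow> real^'n \<Rightarrow> 'n \<Rightarrow> real^'n" where
  "p_g K g x = (\<chi> y. K $ x $ y * exp (g $ y) / Z_g K g x)"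

definition m_g :: "real^'n^'n \<Rightarrow> 'n pmf \<Rightarrow> real^'n \<Rightarrow> real^'n" where
  "m_g K \<mu> g = (\<chi> y. \<Sum>x\<in>UNIV. pmf \<mu> x * p_g K g x $ y)"

definition cal_J :: "real^'n^'n \<Rightarrow> 'n pmf \<Rightarrow> 'n pmf \<Rightarrow> real^'n \<Rightarrow> real" where
  "cal_J K \<mu> \<nu> g = (\<Sum>x\<in>UNIV. pmf \<mu> x * ln (Z_g K g x)) - (\<Sum>y\<in>UNIV. pmf \<nu> y * g $ y)"

definition Dm_g :: "real^'n^'n \<Rightarrow> 'n pmf \<Rightarrow> real^'n \<Rightarrow> real^'n \<Rightarrow> real^'n" where
  "Dm_g K \<mu> g = frechet_derivative (m_g K \<mu>) (at g)"

end

theory Submission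
  imports Defs
begin

text \<open>
  The rows \<open>p_g(\<cdot>|x)\<close> are softmax distributions, and everything follows from the single identity

    \<open>D p_g(y|x)[h] = p_g(y|x) (h(y) - \<Sum>\<^sub>z p_g(z|x) h(z))\<close>

  (\<open>has_derivative_p_g\<close>), whose right-hand side is again a polynomial in the numbers
  \<open>p_g(z|x)\<close>. So the algebra of functions generated by the constants and all \<open>p_g(y|x)\<close> is closed
  under directional derivatives; a family of differentiable functions with this closure property
  consists of smooth functions (\<open>smooth_if_closed_under_derivatives\<close>), and the components of
  \<open>m_g\<close> lie in it.

  Averaging the identity over \<open>\<mu>\<close> gives the derivative of \<open>m_g\<close>; in matrix form it is the
  \<open>\<mu>\<close>-average of the covariance matrices of the rows \<open>p_g(\<cdot>|x)\<close>.
  Finally \<open>h \<mapsto> \<Sum>\<^sub>z p_g(z|x) h(z)\<close> is the derivative of \<open>ln Z_g(x)\<close>, so the gradient of \<open>J\<close> is \<open>m_g - \<nu>\<close> (\<open>gderiv_cal_J\<close>); it differs from \<open>m_g\<close> by a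
  constant, and therefore the Hessian of \<open>J\<close> is the derivative of \<open>m_g\<close>.
\<close>

section \<open>Smoothness from closure under directional derivatives\<close>

text \<open>The closure hypothesis reproduces itself, so one induction on the order of differentiability
  serves the whole family at once.\<close>

lemma smooth_if_closed_under_derivatives:
  assumes closed: "\<And>f. f \<in> F \<Longrightarrow>
      \<exists>D. (\<forall>x. (f has_derivative D x) (at x)) \<and> (\<forall>v. (\<lambda>x. D x v) \<in> F)"
    and "f \<in> F"
  shows "smooth f"
proof -
  have "C_k k f" if "f \<in> F" for k f
    using that
  proof (induction k arbitrary: f)
    case 0
    then show ?case
      using closed[OF 0] by (auto intro: has_derivative_continuous_on has_derivative_at_withinI)
  next
    case (Suc k)
    obtain D where D: "\<And>x. (f has_derivative D x) (at x)" "\<And>v. (\<lambda>x. D x v) \<in> F"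
      using closed[OF Suc.prems] by blast
    have "frechet_derivative f (at x) = D x" for x
      using frechet_derivative_at[OF D(1)] by simp
    then show ?case
      using D Suc.IH by (auto simp: differentiable_def)
  qed
  with \<open>f \<in> F\<close> show ?thesis
    by (simp add: smooth_def)
qed

lemma has_derivative_vec_lambda_components:
  fixes f :: "'i::finite \<Rightarrow> 'a::real_normed_vector \<Rightarrow> real"
  assumes "\<And>i. (f i has_derivative f' i) (at x within S)"
  shows "((\<lambda>x. \<chi> i. f i x) has_derivative (\<lambda>h. \<chi> i. f' i h)) (at x within S)"
  unfolding has_derivative_componentwise_within[of "\<lambda>x. \<chi> i. f i x"] using assms
  by (auto simp: Basis_vec_def inner_axis)

section \<open>The derivative of the tilted kernel\<close>

lemma Z_g_pos:
  assumes "\<And>x y. K $ x $ y > 0"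
  shows "Z_g K g x > 0"
  unfolding Z_g_def using assms by (intro sum_pos) auto

lemma has_derivative_Z_g:
  "((\<lambda>g. Z_g K g x) has_derivative (\<lambda>h. \<Sum>z\<in>UNIV. K $ x $ z * exp (g $ z) * h $ z)) (at g)"
  unfolding Z_g_def
  by (auto intro!: derivative_eq_intros bounded_linear_imp_has_derivative bounded_linear_vec_nth
      simp: mult_ac)

text \<open>Logarithmic differentiation of the partition function yields the mean under the tilted
  distribution, as for the cumulant generating function of an exponential family.\<close>

lemma has_derivative_ln_Z_g:
  assumes "\<And>x y. K $ x $ y > 0"
  shows "((\<lambda>g. ln (Z_g K g x)) has_derivative (\<lambda>h. \<Sum>z\<in>UNIV. p_g K g x $ z * h $ z)) (at g)"
proof -
  have "((\<lambda>g. ln (Z_g K g x)) has_derivative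
      (\<lambda>h. (\<Sum>z\<in>UNIV. K $ x $ z * exp (g $ z) * h $ z) * inverse (Z_g K g x))) (at g)"
    using has_derivative_ln[OF Z_g_pos[OF assms] has_derivative_Z_g]
    by (simp add: divide_inverse)
  then show ?thesis
    by (simp add: p_g_def sum_distrib_left divide_inverse mult_ac)
qed

lemma has_derivative_p_g:
  assumes "\<And>x y. K $ x $ y > 0"
  shows "((\<lambda>g. p_g K g x $ y) has_derivative
      (\<lambda>h. p_g K g x $ y * (h $ y - (\<Sum>z\<in>UNIV. p_g K g x $ z * h $ z)))) (at g)"
proof -
  \<comment> \<open>In this form the quotient rule is absorbed into the derivative of \<open>ln Z_g\<close>.\<close>
  have eq: "p_g K g x $ y = K $ x $ y * exp (g $ y - ln (Z_g K g x))" for g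
    by (simp add: p_g_def exp_diff exp_ln[OF Z_g_pos[OF assms]])
  have nth: "((\<lambda>g. g $ y) has_derivative (\<lambda>h. h $ y)) (at g)"
    by (intro bounded_linear_imp_has_derivative bounded_linear_vec_nth)
  have "((\<lambda>g. K $ x $ y * exp (g $ y - ln (Z_g K g x))) has_derivative
      (\<lambda>h. K $ x $ y * ((h $ y - (\<Sum>z\<in>UNIV. p_g K g x $ z * h $ z)) *
        exp (g $ y - ln (Z_g K g x))))) (at g)"
    by (intro has_derivative_mult_right has_derivative_exp has_derivative_diff nth
        has_derivative_ln_Z_g assms)
  then show ?thesis
    by (simp add: eq mult_ac)
qed

section \<open>Polynomials in the tilted probabilities\<close>

inductive_set p_g_algebra :: "real^'n^'n \<Rightarrow> (real^'n \<Rightarrow> real) set" for K where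
  const: "(\<lambda>_. c) \<in> p_g_algebra K"
| entry: "(\<lambda>g. p_g K g x $ y) \<in> p_g_algebra K"
| add: "f \<in> p_g_algebra K \<Longrightarrow> f' \<in> p_g_algebra K \<Longrightarrow> (\<lambda>g. f g + f' g) \<in> p_g_algebra K"
| mult: "f \<in> p_g_algebra K \<Longrightarrow> f' \<in> p_g_algebra K \<Longrightarrow> (\<lambda>g. f g * f' g) \<in> p_g_algebra K"

lemma p_g_algebra_sum:
  assumes "finite A" "\<And>i. i \<in> A \<Longrightarrow> f i \<in> p_g_algebra K"
  shows "(\<lambda>g. \<Sum>i\<in>A. f i g) \<in> p_g_algebra K"
  using assms by (induction A rule: finite_induct) (auto intro: p_g_algebra.intros)

text \<open>The directional derivatives of each \<open>p_g(y|x)\<close> are quadratic polynomials in the row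
  \<open>p_g(\<cdot>|x)\<close>; the sum and product rules extend this closure to the whole algebra.\<close>

lemma p_g_algebra_closed_under_derivatives:
  assumes pos: "\<And>x y. K $ x $ y > 0" and "f \<in> p_g_algebra K"
  shows "\<exists>D. (\<forall>g. (f has_derivative D g) (at g)) \<and> (\<forall>v. (\<lambda>g. D g v) \<in> p_g_algebra K)"
  using assms(2)
proof induction
  case (const c)
  then show ?case
    by (intro exI[of _ "\<lambda>_ _. 0"]) (auto intro: p_g_algebra.const)
next
  case (entry x y)
  let ?D = "\<lambda>g h. p_g K g x $ y * (h $ y + (-1) * (\<Sum>z\<in>UNIV. p_g K g x $ z * h $ z))"
  have "((\<lambda>g. p_g K g x $ y) has_derivative ?D g) (at g)" for g
    using has_derivative_p_g[OF pos] by simp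
  moreover have "(\<lambda>g. ?D g v) \<in> p_g_algebra K" for v
    by (intro p_g_algebra.intros p_g_algebra_sum) auto
  ultimately show ?case
    by (intro exI[of _ ?D]) simp
next
  case (add f f')
  then obtain D D' where D: "\<And>g. (f has_derivative D g) (at g)" "\<And>v. (\<lambda>g. D g v) \<in> p_g_algebra K"
    and D': "\<And>g. (f' has_derivative D' g) (at g)" "\<And>v. (\<lambda>g. D' g v) \<in> p_g_algebra K"
    by blast
  show ?case
    by (intro exI[of _ "\<lambda>g v. D g v + D' g v"] conjI allI has_derivative_add p_g_algebra.intros D D')
next
  case (mult f f')
  then obtain D D' where D: "\<And>g. (f has_derivative D g) (at g)" "\<And>v. (\<lambda>g. D g v) \<in> p_g_algebra K"
    and D': "\<And>g. (f' has_derivative D' g) (at g)" "\<And>v. (\<lambda>g. D' g v) \<in> p_g_algebra K"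
    by blast
  show ?case
    by (intro exI[of _ "\<lambda>g v. f g * D' g v + D g v * f' g"] conjI allI has_derivative_mult
        p_g_algebra.intros D D' mult.hyps)
qed

lemma smooth_m_g:
  assumes pos: "\<And>x y. K $ x $ y > 0"
  shows "smooth (m_g K \<mu>)"
proof (rule smooth_if_closed_under_derivatives)
  let ?F = "{(\<lambda>g. \<chi> y. a y g) | a. \<forall>y. a y \<in> p_g_algebra K}"
  have "m_g K \<mu> = (\<lambda>g. \<chi> y. \<Sum>x\<in>UNIV. pmf \<mu> x * p_g K g x $ y)"
    by (simp add: m_g_def fun_eq_iff)
  moreover have "(\<lambda>g. \<Sum>x\<in>UNIV. pmf \<mu> x * p_g K g x $ y) \<in> p_g_algebra K" for y
    by (intro p_g_algebra.intros p_g_algebra_sum) auto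
  ultimately show "m_g K \<mu> \<in> ?F"
    by (intro CollectI exI[of _ "\<lambda>y g. \<Sum>x\<in>UNIV. pmf \<mu> x * p_g K g x $ y"]) auto
  fix f assume "f \<in> ?F"
  then obtain a where f: "f = (\<lambda>g. \<chi> y. a y g)" and a: "\<And>y. a y \<in> p_g_algebra K"
    by blast
  obtain D where D: "\<And>y g. (a y has_derivative D y g) (at g)"
      "\<And>y v. (\<lambda>g. D y g v) \<in> p_g_algebra K"
    using p_g_algebra_closed_under_derivatives[OF pos a] by metis
  have "(\<lambda>g. \<chi> y. D y g v) \<in> ?F" for v
    using D(2) by (intro CollectI exI[of _ "\<lambda>y g. D y g v"]) auto
  then show "\<exists>D. (\<forall>g. (f has_derivative D g) (at g)) \<and> (\<forall>v. (\<lambda>g. D g v) \<in> ?F)"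
    unfolding f
    by (intro exI[of _ "\<lambda>g v. \<chi> y. D y g v"] conjI allI has_derivative_vec_lambda_components D)
qed

section \<open>The differential of the marginal map and the Hessian\<close>

lemma has_derivative_m_g:
  assumes "\<And>x y. K $ x $ y > 0"
  shows "(m_g K \<mu> has_derivative (\<lambda>h. \<chi> y. \<Sum>x\<in>UNIV. pmf \<mu> x * p_g K g x $ y *
      (h $ y - (\<Sum>z\<in>UNIV. p_g K g x $ z * h $ z)))) (at g)"
  unfolding m_g_def mult.assoc
  by (intro has_derivative_vec_lambda_components has_derivative_sum has_derivative_mult_right
      has_derivative_p_g assms)

lemma Diag_minus_outer_mult_vec:
  "((Diag p - outer p p) *v h) $ y = p $ y * (h $ y - (\<Sum>z\<in>UNIV. p $ z * h $ z))"
proof -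
  have "((Diag p - outer p p) *v h) $ y =
      (\<Sum>z\<in>UNIV. (if y = z then p $ y * h $ z else 0) - p $ y * (p $ z * h $ z))"
    by (auto simp: matrix_vector_mult_def Diag_def outer_def left_diff_distrib intro!: sum.cong)
  then show ?thesis
    by (simp add: sum_subtractf sum_distrib_left right_diff_distrib)
qed

lemma sum_scaleR_matrix_mult_vec:
  fixes A :: "'i \<Rightarrow> real^'n^'m"
  shows "((\<Sum>i\<in>I. c i *\<^sub>R A i) *v h) $ y = (\<Sum>i\<in>I. c i * (A i *v h) $ y)"
  by (induction I rule: infinite_finite_induct)
    (simp_all add: matrix_vector_mult_add_rdistrib scaleR_matrix_vector_assoc[symmetric])

text \<open>By \<open>has_derivative_ln_Z_g\<close>, averaging the derivatives of \<open>ln Z_g(x)\<close> over \<open>\<mu>\<close> pairs \<open>h\<close> with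
  \<open>m_g\<close>, since \<open>m_g\<close> is the \<open>\<mu>\<close>-average of the rows \<open>p_g(\<cdot>|x)\<close>.\<close>

lemma gderiv_cal_J:
  assumes "\<And>x y. K $ x $ y > 0"
  shows "GDERIV (cal_J K \<mu> \<nu>) g :> m_g K \<mu> g - (\<chi> y. pmf \<nu> y)"
proof -
  have nth: "((\<lambda>g. g $ y) has_derivative (\<lambda>h. h $ y)) (at g)" for y
    by (intro bounded_linear_imp_has_derivative bounded_linear_vec_nth)
  have deriv: "(cal_J K \<mu> \<nu> has_derivative (\<lambda>h.
      (\<Sum>x\<in>UNIV. pmf \<mu> x * (\<Sum>z\<in>UNIV. p_g K g x $ z * h $ z)) - (\<Sum>y\<in>UNIV. pmf \<nu> y * h $ y))) (at g)"
    unfolding cal_J_def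
    by (intro has_derivative_diff has_derivative_sum has_derivative_mult_right
        has_derivative_ln_Z_g nth assms)
  have "(\<Sum>x\<in>UNIV. pmf \<mu> x * (\<Sum>z\<in>UNIV. p_g K g x $ z * h $ z)) - (\<Sum>y\<in>UNIV. pmf \<nu> y * h $ y)
      = h \<bullet> (m_g K \<mu> g - (\<chi> y. pmf \<nu> y))" for h
  proof -
    have "(\<Sum>x\<in>UNIV. pmf \<mu> x * (\<Sum>z\<in>UNIV. p_g K g x $ z * h $ z)) =
        (\<Sum>z\<in>UNIV. \<Sum>x\<in>UNIV. pmf \<mu> x * (p_g K g x $ z * h $ z))"
      unfolding sum_distrib_left by (rule sum.swap)
    also have "\<dots> = h \<bullet> m_g K \<mu> g"
      by (simp add: inner_vec_def m_g_def sum_distrib_left mult_ac)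
    finally show ?thesis
      by (simp add: inner_diff_right) (simp add: inner_vec_def mult.commute)
  qed
  with deriv show ?thesis
    by (simp add: gderiv_def)
qed

theorem proposition4p1:
  fixes Q K :: "real^'n^'n" and \<mu> \<nu> :: "'n pmf"
  assumes "generator Q"
    and "K = mat_exp Q"
    and "\<And>x y. K $ x $ y > 0"
    and "\<And>x. pmf \<mu> x > 0"
    and "\<And>y. pmf \<nu> y > 0"
  shows "smooth (m_g K \<mu>)
    \<and> (\<forall>g. (m_g K \<mu> has_derivative Dm_g K \<mu> g) (at g)
        \<and> has_hessian (cal_J K \<mu> \<nu>) (Dm_g K \<mu> g) g
        \<and> Dm_g K \<mu> g =
            (*v) (\<Sum>x\<in>UNIV. pmf \<mu> x *\<^sub>R (Diag (p_g K g x) - outer (p_g K g x) (p_g K g x)))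
        \<and> (\<forall>h y. Dm_g K \<mu> g h $ y =
            (\<Sum>x\<in>UNIV. pmf \<mu> x * p_g K g x $ y * (h $ y - (\<Sum>z\<in>UNIV. p_g K g x $ z * h $ z)))))"
proof -
  note pos = assms(3)
  have Dm: "Dm_g K \<mu> g = (\<lambda>h. \<chi> y. \<Sum>x\<in>UNIV. pmf \<mu> x * p_g K g x $ y *
      (h $ y - (\<Sum>z\<in>UNIV. p_g K g x $ z * h $ z)))" for g
    unfolding Dm_g_def by (rule frechet_derivative_at[OF has_derivative_m_g[OF pos], symmetric])
  have deriv: "(m_g K \<mu> has_derivative Dm_g K \<mu> g) (at g)" for g
    unfolding Dm by (rule has_derivative_m_g[OF pos])
  have "((\<lambda>g. m_g K \<mu> g - (\<chi> y. pmf \<nu> y)) has_derivative Dm_g K \<mu> g) (at g)" for g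
    using has_derivative_diff[OF deriv has_derivative_const] by simp
  then have "has_hessian (cal_J K \<mu> \<nu>) (Dm_g K \<mu> g) g" for g
    unfolding has_hessian_def using gderiv_cal_J[OF pos]
    by (intro exI[of _ "\<lambda>g. m_g K \<mu> g - (\<chi> y. pmf \<nu> y)"]) simp
  moreover have "Dm_g K \<mu> g =
      (*v) (\<Sum>x\<in>UNIV. pmf \<mu> x *\<^sub>R (Diag (p_g K g x) - outer (p_g K g x) (p_g K g x)))" for g
    by (simp add: Dm fun_eq_iff vec_eq_iff sum_scaleR_matrix_mult_vec Diag_minus_outer_mult_vec
        mult.assoc)
  moreover have "Dm_g K \<mu> g h $ y =
      (\<Sum>x\<in>UNIV. pmf \<mu> x * p_g K g x $ y * (h $ y - (\<Sum>z\<in>UNIV. p_g K g x $ z * h $ z)))" for g h y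
    by (simp add: Dm)
  ultimately show ?thesis
    using smooth_m_g[OF pos] deriv by blast
qed

end
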